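(* Let $Q\in\mathbb{R}^{n\times n}$ be symmetric with $\lambda_Q<0$, let $g\in\mathbb{R}^n$, $A\in\mathbb{R}^{m\times n}$, $b\in\mathbb{R}^m$, and let $\mathcal{K}\subseteq\mathbb{R}^m$ be a closed convex cone such that $\{y\in\mathbb{R}^n:\|y\|\le 1,\ Ay-b\in\mathcal{K}\}$ is nonempty. Suppose that there exists $d\in\mathbb{R}^n$, $d\ne0$, such that $Qd=\lambda_Q d$, $Ad\in\mathcal{K}$ and $-Ad\in\mathcal{K}$. Let $$X:=\left\{[y;1;x_{n+2}]\in\mathbb{R}^{n+2}:\ \|y\|\le 1,\ Ay-b\in\mathcal{K},\ y^\top Qy+2g^\top y\le x_{n+2}\right\}.$$ Then $$\mathrm{conv}(X)=\left\{[y;1;x_{n+2}]\in\mathbb{R}^{n+2}:\ \|y\|\le 1,\ y^\top(Q-\lambda_Q I_n)y+2g^\top y+\lambda_Q\le x_{n+2},\ Ay-b\in\mathcal{K}\right\}.$$ As a result, $$\min_y\left\{y^\top Qy+2g^\top y:\ \|y\|\le 1,\ Ay-b\in\mathcal{K}\right\}=\min_y\left\{y^\top(Q-\lambda_Q I_n)y+2g^\top y+\lambda_Q:\ \|y\|\le 1,\ Ay-b\in\mathcal{K}\right\}.$$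
   Context: $\|\cdot\|$ is the Euclidean norm, $\lambda_Q:=\lambda_{\min}(Q)$ is the minimum eigenvalue of $Q$, and $\mathrm{conv}$ denotes the convex hull. $[y;1;x_{n+2}]$ denotes the vector in $\mathbb{R}^{n+2}$ obtained by stacking $y\in\mathbb{R}^n$, $1$ and $x_{n+2}\in\mathbb{R}$. *)

theory Defs
  imports "HOL-Analysis.Analysis"
begin

definition eigenvalues :: "real ^ 'n ^ 'n \<Rightarrow> real set" where
  "eigenvalues Q = {l. \<exists>v. v \<noteq> 0 \<and> Q *v v = l *\<^sub>R v}"

(* Meaningful for symmetric Q, whose set of real eigenvalues is finite and nonempty. *)
definition min_eigenvalue :: "real ^ 'n ^ 'n \<Rightarrow> real" where
  "min_eigenvalue Q = Min (eigenvalues Q)"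

(* The column vector [y; s; t] of dimension n + 2. The last two coordinates are indexed
   by the numeral type 2, whose first index is 1 and whose second index is 2 (= 0), as in
   the library function vector. *)
definition stack :: "real ^ 'n \<Rightarrow> real \<Rightarrow> real \<Rightarrow> real ^ ('n + 2)" where
  "stack y s t = (\<chi> i. case i of Inl j \<Rightarrow> y $ j | Inr k \<Rightarrow> (vector [s, t] :: real ^ 2) $ k)"

lemma stack_nth [simp]:
  "stack y s t $ Inl j = y $ j"
  "stack y s t $ Inr 1 = s"
  "stack y s t $ Inr 2 = t"
  by (simp_all only: stack_def vec_lambda_beta sum.case vector_2)

end

(*
  Write l for the least eigenvalue and p for the function with Q - l I in place of Q. Since Q - l I
  is positive semidefinite, p is convex, and p - q = l (1 - |y|^2), so p lies below the original
  function q on the unit ball and agrees with it on the unit sphere. Along the line through y in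
  the direction of the eigenvector d, the function p is affine and the conic constraint is
  preserved, so y can be moved both ways to the sphere: every point of the epigraph of p is on a
  segment between two points of the epigraph of q, and moving y in the direction in which p does
  not increase shows that the minima agree.
*)
theory Submission
  imports Defs
begin

section \<open>Quadratic forms of symmetric matrices and the least eigenvalue\<close>

lemma symmetric_matrix_inner:
  fixes M :: "real ^ 'n ^ 'n"
  assumes "transpose M = M"
  shows "x \<bullet> (M *v y) = y \<bullet> (M *v x)"
  by (metis assms dot_lmul_matrix inner_commute transpose_matrix_vector)

lemma symmetric_matrix_form_add:
  fixes M :: "real ^ 'n ^ 'n"
  assumes "transpose M = M"
  shows "(x + c *\<^sub>R y) \<bullet> (M *v (x + c *\<^sub>R y)) =
    x \<bullet> (M *v x) + 2 * c * (y \<bullet> (M *v x)) + c\<^sup>2 * (y \<bullet> (M *v y))"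
  using symmetric_matrix_inner[OF assms, of x y]
  by (simp add: matrix_vector_right_distrib matrix_vector_mult_scaleR inner_add_left
      inner_add_right power2_eq_square algebra_simps)

lemma shifted_matrix_vector_mult:
  fixes Q :: "real ^ 'n ^ 'n"
  shows "(Q - l *\<^sub>R mat 1) *v y = Q *v y - l *\<^sub>R y"
  by (simp add: matrix_vector_mult_diff_rdistrib flip: scaleR_matrix_vector_assoc)

lemma transpose_shifted_matrix:
  fixes Q :: "real ^ 'n ^ 'n"
  assumes "transpose Q = Q"
  shows "transpose (Q - l *\<^sub>R mat 1) = Q - l *\<^sub>R mat 1"
  using assms by (auto simp: transpose_def mat_def vec_eq_iff)

lemma continuous_on_form:
  fixes M :: "real ^ 'n ^ 'n"
  shows "continuous_on S (\<lambda>y. y \<bullet> (M *v y))"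
  by (intro continuous_intros)

text \<open>Eigenvectors for distinct eigenvalues are orthogonal, hence independent, and an
  independent set is finite here. This lets the \<open>Min\<close> in \<open>min_eigenvalue\<close>
  be compared with a given eigenvalue.\<close>

lemma finite_eigenvalues:
  fixes Q :: "real ^ 'n ^ 'n"
  assumes sym: "transpose Q = Q"
  shows "finite (eigenvalues Q)"
proof -
  have "\<forall>l\<in>eigenvalues Q. \<exists>v. v \<noteq> 0 \<and> Q *v v = l *\<^sub>R v"
    by (simp add: eigenvalues_def)
  then obtain f where f: "\<And>l. l \<in> eigenvalues Q \<Longrightarrow> f l \<noteq> 0 \<and> Q *v f l = l *\<^sub>R f l"
    using bchoice by metis
  have orth: "f k \<bullet> f l = 0" if "k \<in> eigenvalues Q" "l \<in> eigenvalues Q" "k \<noteq> l" for k l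
    using symmetric_matrix_inner[OF sym, of "f k" "f l"] f that by (simp add: inner_commute)
  have inj: "inj_on f (eigenvalues Q)"
    using f orth by (metis inj_onI inner_eq_zero_iff)
  have "pairwise orthogonal (f ` eigenvalues Q)"
    using orth by (auto simp: pairwise_def orthogonal_def)
  moreover have "0 \<notin> f ` eigenvalues Q"
    using f by auto
  ultimately have "finite (f ` eigenvalues Q)"
    by (intro independent_imp_finite pairwise_orthogonal_independent)
  then show ?thesis
    using inj finite_imageD by blast
qed

text \<open>A zero of a nonnegative form is a minimum point of it, so the gradient
  \<open>2 * (M *v v)\<close> has to vanish there. The proof perturbs \<open>v\<close> against that
  gradient.\<close>

lemma psd_form_zero_imp_kernel:
  fixes M :: "real ^ 'n ^ 'n"
  assumes sym: "transpose M = M"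
    and psd: "\<And>x. 0 \<le> x \<bullet> (M *v x)"
    and zero: "v \<bullet> (M *v v) = 0"
  shows "M *v v = 0"
proof (rule ccontr)
  assume nz: "M *v v \<noteq> 0"
  define w where "w = M *v v"
  define a where "a = w \<bullet> w"
  define c where "c = w \<bullet> (M *v w)"
  have a: "0 < a" and c: "0 \<le> c"
    using nz psd by (simp_all add: a_def w_def c_def)
  \<comment> \<open>The form at \<open>v + s w\<close> is \<open>2 s a + s\<^sup>2 c\<close>, which is negative for small negative \<open>s\<close>.\<close>
  define s where "s = - a / (c + 1)"
  have s: "s < 0"
    using a c by (simp add: s_def field_simps)
  have "0 \<le> 2 * s * a + s\<^sup>2 * c"
    using psd[of "v + s *\<^sub>R w"] zero
    by (simp add: symmetric_matrix_form_add[OF sym] a_def c_def flip: w_def)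
  also have "\<dots> = s * (2 * a + s * c)"
    by (simp add: power2_eq_square algebra_simps)
  \<comment> \<open>The \<open>+ 1\<close> in the denominator of \<open>s\<close> covers the case
    \<open>c = 0\<close>. The second factor becomes \<open>a - s\<close>, which is positive.\<close>
  also have "s * c = - a - s"
    using c by (simp add: s_def field_simps)
  also have "s * (2 * a + (- a - s)) < 0"
    using s a by (intro mult_neg_pos) auto
  finally show False
    by simp
qed

text \<open>Rayleigh's argument: the form attains a minimum \<open>r\<close> on the unit sphere. By
  homogeneity the form of Q - r I is nonnegative, and it vanishes at the minimizer, which is
  therefore an eigenvector for \<open>r\<close>.\<close>

lemma min_eigenvalue_le_form:
  fixes Q :: "real ^ 'n ^ 'n"
  assumes sym: "transpose Q = Q"
  shows "min_eigenvalue Q * (norm y)\<^sup>2 \<le> y \<bullet> (Q *v y)"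
proof -
  have "\<exists>v\<in>sphere 0 1. \<forall>x\<in>sphere (0::real^'n) 1. v \<bullet> (Q *v v) \<le> x \<bullet> (Q *v x)"
    by (rule continuous_attains_inf[OF _ _ continuous_on_form]) auto
  then obtain v where v: "norm v = 1"
    and min: "\<And>x. norm x = 1 \<Longrightarrow> v \<bullet> (Q *v v) \<le> x \<bullet> (Q *v x)"
    by auto
  define r where "r = v \<bullet> (Q *v v)"
  have r: "r * (norm x)\<^sup>2 \<le> x \<bullet> (Q *v x)" for x
  proof (cases "x = 0")
    case False
    then show ?thesis
      using min[of "sgn x"]
      by (simp add: sgn_div_norm r_def matrix_vector_mult_scaleR power2_eq_square field_simps)
  qed simp
  have "(Q - r *\<^sub>R mat 1) *v v = 0"
  proof (rule psd_form_zero_imp_kernel)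
    show "transpose (Q - r *\<^sub>R mat 1) = Q - r *\<^sub>R mat 1"
      by (rule transpose_shifted_matrix[OF sym])
    show "0 \<le> x \<bullet> ((Q - r *\<^sub>R mat 1) *v x)" for x
      using r[of x] by (simp add: shifted_matrix_vector_mult inner_diff_right power2_norm_eq_inner)
    show "v \<bullet> ((Q - r *\<^sub>R mat 1) *v v) = 0"
      using v by (simp add: shifted_matrix_vector_mult inner_diff_right r_def norm_eq_1)
  qed
  then have "r \<in> eigenvalues Q"
    using v by (auto simp: eigenvalues_def shifted_matrix_vector_mult intro!: exI[of _ v])
  then have "min_eigenvalue Q \<le> r"
    unfolding min_eigenvalue_def using finite_eigenvalues[OF sym] by (rule Min_le[rotated])
  then have "min_eigenvalue Q * (norm y)\<^sup>2 \<le> r * (norm y)\<^sup>2"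
    by (intro mult_right_mono) auto
  then show ?thesis
    using r[of y] by linarith
qed

text \<open>The gap in the convexity inequality is exactly \<open>t * (1 - t)\<close> times the form
  at \<open>y - x\<close>.\<close>

lemma convex_on_psd_form:
  fixes M :: "real ^ 'n ^ 'n"
  assumes sym: "transpose M = M" and psd: "\<And>x. 0 \<le> x \<bullet> (M *v x)"
  shows "convex_on UNIV (\<lambda>y. y \<bullet> (M *v y))"
proof (rule convex_onI)
  fix t :: real and x y :: "real ^ 'n"
  assume t: "0 < t" "t < 1"
  let ?z = "y - x"
  have z: "(1 - t) *\<^sub>R x + t *\<^sub>R y = x + t *\<^sub>R ?z" "y = x + 1 *\<^sub>R ?z"
    by (simp_all add: algebra_simps)
  have y: "y \<bullet> (M *v y) = x \<bullet> (M *v x) + 2 * (?z \<bullet> (M *v x)) + ?z \<bullet> (M *v ?z)"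
    using symmetric_matrix_form_add[OF sym, of x 1 ?z] by simp
  have "0 \<le> t * (1 - t) * (?z \<bullet> (M *v ?z))"
    using t psd[of ?z] by simp
  then show "((1 - t) *\<^sub>R x + t *\<^sub>R y) \<bullet> (M *v ((1 - t) *\<^sub>R x + t *\<^sub>R y)) \<le>
      (1 - t) * (x \<bullet> (M *v x)) + t * (y \<bullet> (M *v y))"
    unfolding z(1) symmetric_matrix_form_add[OF sym] y
    by (simp add: algebra_simps power2_eq_square)
qed simp

section \<open>Rays in the unit ball and combinations of stacked vectors\<close>

lemma ray_meets_unit_sphere:
  fixes y d :: "'a :: real_normed_vector"
  assumes "norm y \<le> 1" "d \<noteq> 0"
  obtains s where "0 \<le> s" "norm (y + s *\<^sub>R d) = 1"
proof -
  \<comment> \<open>The displacement has length 2, so its endpoint has norm at least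
    \<open>2 - norm y\<close>, hence at least 1. The start has norm at most 1, and the intermediate
    value theorem gives the crossing.\<close>
  have "norm ((2 / norm d) *\<^sub>R d) - norm y \<le> norm (y + (2 / norm d) *\<^sub>R d)"
    by (metis add.commute norm_diff_ineq)
  then have "\<exists>s\<ge>0. s \<le> 2 / norm d \<and> norm (y + s *\<^sub>R d) = 1"
    using assms by (intro IVT') (auto intro!: continuous_intros)
  then show thesis
    using that by auto
qed

lemma stack_convex_comb:
  "u *\<^sub>R stack y s t + v *\<^sub>R stack y' s' t' =
    stack (u *\<^sub>R y + v *\<^sub>R y') (u * s + v * s') (u * t + v * t')"
  unfolding vec_eq_iff
proof
  fix i :: "'a + 2"
  show "(u *\<^sub>R stack y s t + v *\<^sub>R stack y' s' t') $ i =
    stack (u *\<^sub>R y + v *\<^sub>R y') (u * s + v * s') (u * t + v * t') $ i"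
  proof (cases i)
    case (Inr k)
    then show ?thesis
      using exhaust_2[of k] by (auto simp only: vector_add_component vector_scaleR_component stack_nth real_scaleR_def)
  qed simp
qed

section \<open>The convex hull and the two minima\<close>

theorem corollary14:
  fixes Q :: "real ^ 'n ^ 'n"
    and g :: "real ^ 'n"
    and A :: "real ^ 'n ^ 'm"
    and b :: "real ^ 'm"
    and K :: "(real ^ 'm) set"
  assumes "transpose Q = Q"
    and "min_eigenvalue Q < 0"
    and "closed K" and "convex K" and "cone K"
    and "{y. norm y \<le> 1 \<and> A *v y - b \<in> K} \<noteq> {}"
    and "\<exists>d. d \<noteq> 0 \<and> Q *v d = min_eigenvalue Q *\<^sub>R d \<and> A *v d \<in> K \<and> - (A *v d) \<in> K"
  shows
    "(convex hull {stack y 1 t | y t.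
        norm y \<le> 1 \<and> A *v y - b \<in> K \<and> y \<bullet> (Q *v y) + 2 * (g \<bullet> y) \<le> t} =
      {stack y 1 t | y t.
        norm y \<le> 1 \<and>
        y \<bullet> ((Q - min_eigenvalue Q *\<^sub>R mat 1) *v y) + 2 * (g \<bullet> y) + min_eigenvalue Q \<le> t \<and>
        A *v y - b \<in> K}) \<and>
    (\<exists>y z.
      is_arg_min (\<lambda>y. y \<bullet> (Q *v y) + 2 * (g \<bullet> y))
        (\<lambda>y. norm y \<le> 1 \<and> A *v y - b \<in> K) y \<and>
      is_arg_min
        (\<lambda>y. y \<bullet> ((Q - min_eigenvalue Q *\<^sub>R mat 1) *v y) + 2 * (g \<bullet> y) + min_eigenvalue Q)
        (\<lambda>y. norm y \<le> 1 \<and> A *v y - b \<in> K) z \<and>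
      y \<bullet> (Q *v y) + 2 * (g \<bullet> y) =
        z \<bullet> ((Q - min_eigenvalue Q *\<^sub>R mat 1) *v z) + 2 * (g \<bullet> z) + min_eigenvalue Q)"
proof -
  define l where "l = min_eigenvalue Q"
  define C where "C = {y. norm y \<le> 1 \<and> A *v y - b \<in> K}"
  define q where "q = (\<lambda>y. y \<bullet> (Q *v y) + 2 * (g \<bullet> y))"
  define p where "p = (\<lambda>y. y \<bullet> ((Q - l *\<^sub>R mat 1) *v y) + 2 * (g \<bullet> y) + l)"
  obtain d where d: "d \<noteq> 0" "Q *v d = l *\<^sub>R d" "A *v d \<in> K" "- (A *v d) \<in> K"
    using assms(7) unfolding l_def by blast
  have sym: "transpose (Q - l *\<^sub>R mat 1) = Q - l *\<^sub>R mat 1"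
    by (rule transpose_shifted_matrix[OF assms(1)])
  have pq: "p y = q y + l * (1 - (norm y)\<^sup>2)" for y
    unfolding p_def q_def shifted_matrix_vector_mult
    by (simp add: inner_diff_right power2_norm_eq_inner right_diff_distrib)
  have p_le_q: "p y \<le> q y" if "y \<in> C" for y
  proof -
    have "l * (1 - (norm y)\<^sup>2) \<le> 0"
      using assms(2) that by (intro mult_nonpos_nonneg) (auto simp: l_def C_def power_le_one)
    then show ?thesis
      using pq by simp
  qed
  \<comment> \<open>Since \<open>d\<close> is in the kernel of Q - l I, the quadratic term vanishes,
    and by symmetry so does the cross term.\<close>
  have p_line: "p (y + s *\<^sub>R d) = p y + s * (2 * (g \<bullet> d))" for y s
  proof -
    have "(Q - l *\<^sub>R mat 1) *v d = 0"
      using d by (simp add: shifted_matrix_vector_mult)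
    then show ?thesis
      using symmetric_matrix_inner[OF sym, of d y]
      by (simp add: p_def symmetric_matrix_form_add[OF sym] inner_add_right)
  qed
  \<comment> \<open>Stated for a general direction so that it serves both \<open>d\<close> and
    \<open>- d\<close>. A convex cone is closed under adding nonnegative multiples of its elements,
    so the conic constraint survives up to the sphere, where the correction in \<open>pq\<close> is
    zero.\<close>
  have move: "\<exists>s\<ge>0. y + s *\<^sub>R e \<in> C \<and> q (y + s *\<^sub>R e) = p (y + s *\<^sub>R e)"
    if y: "y \<in> C" and e: "e \<noteq> 0" "A *v e \<in> K" for y e
  proof -
    obtain s where s: "0 \<le> s" "norm (y + s *\<^sub>R e) = 1"
      using y e ray_meets_unit_sphere unfolding C_def by blast
    have "(A *v y - b) + s *\<^sub>R (A *v e) \<in> K"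
      using y e s convex_cone[of K] assms(4,5) unfolding C_def by blast
    then have "y + s *\<^sub>R e \<in> C"
      using s by (simp add: C_def matrix_vector_right_distrib matrix_vector_mult_scaleR algebra_simps)
    then show ?thesis
      using s pq[of "y + s *\<^sub>R e"] by auto
  qed
  have forward: "\<exists>s\<ge>0. y + s *\<^sub>R d \<in> C \<and> q (y + s *\<^sub>R d) = p (y + s *\<^sub>R d)"
    and backward: "\<exists>s\<ge>0. y + (- s) *\<^sub>R d \<in> C \<and> q (y + (- s) *\<^sub>R d) = p (y + (- s) *\<^sub>R d)"
    if "y \<in> C" for y
    using move[OF that, of d] move[OF that, of "- d"] d matrix_vector_mult_scaleR[of A "- 1" d]
    by auto
  \<comment> \<open>For convexity the constraint is read as membership of \<open>A *v y\<close> in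
    the translate of \<open>K\<close> by \<open>b\<close>, a preimage under a linear map. For
    closedness below, the preimage of \<open>K\<close> under the affine map suffices.\<close>
  have "convex ((\<lambda>y. A *v y) -` ((+) b ` K))"
    by (intro convex_linear_vimage convex_translation assms) simp
  moreover have "C = cball 0 1 \<inter> ((\<lambda>y. A *v y) -` ((+) b ` K))"
    by (force simp: C_def image_iff)
  ultimately have convC: "convex C"
    by (simp add: convex_Int)
  have "closed ((\<lambda>y. A *v y - b) -` K)"
    by (intro continuous_closed_vimage assms continuous_intros)
  then have compC: "compact C"
    using compact_Int_closed[of "cball 0 1" "(\<lambda>y. A *v y - b) -` K"]
    by (simp add: C_def vimage_def Int_def)
  have convp: "convex_on C p"
  proof -
    have "0 \<le> x \<bullet> ((Q - l *\<^sub>R mat 1) *v x)" for x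
      using min_eigenvalue_le_form[OF assms(1), of x]
      by (simp add: l_def shifted_matrix_vector_mult inner_diff_right power2_norm_eq_inner)
    then have "convex_on C (\<lambda>y. y \<bullet> ((Q - l *\<^sub>R mat 1) *v y))"
      using convex_on_psd_form[OF sym] convC convex_on_subset by blast
    moreover have "convex_on C (\<lambda>y. 2 * (g \<bullet> y) + l)"
      using convC by (auto simp: convex_on_def inner_add_right algebra_simps simp flip: distrib_right)
    ultimately show ?thesis
      unfolding p_def by (simp add: convex_on_add add.assoc)
  qed
  let ?X = "{stack y 1 t | y t. y \<in> C \<and> q y \<le> t}"
  let ?Y = "{stack y 1 t | y t. y \<in> C \<and> p y \<le> t}"
  have "convex hull ?X = ?Y"
  proof (rule antisym)
    \<comment> \<open>\<open>?Y\<close> is a copy of the epigraph of the convex function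
      \<open>p\<close> over \<open>C\<close>; it contains \<open>?X\<close> because \<open>p\<close>
      lies below \<open>q\<close>.\<close>
    have "convex ?Y"
    proof (rule convexI, clarify)
      fix u v :: real and y t y' t'
      assume *: "0 \<le> u" "0 \<le> v" "u + v = 1" "y \<in> C" "p y \<le> t" "y' \<in> C" "p y' \<le> t'"
      have "p (u *\<^sub>R y + v *\<^sub>R y') \<le> u * p y + v * p y'"
        using convp * unfolding convex_on_def by blast
      also have "\<dots> \<le> u * t + v * t'"
        using * by (intro add_mono mult_left_mono)
      finally show "\<exists>z r. u *\<^sub>R stack y 1 t + v *\<^sub>R stack y' 1 t' = stack z 1 r \<and> z \<in> C \<and> p z \<le> r"
        using * convexD[OF convC, of y y' u v]
        by (intro exI[of _ "u *\<^sub>R y + v *\<^sub>R y'"] exI[of _ "u * t + v * t'"])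
          (auto simp: stack_convex_comb)
    qed
    moreover have "?X \<subseteq> ?Y"
      using p_le_q order_trans by blast
    ultimately show "convex hull ?X \<subseteq> ?Y"
      by (intro hull_minimal)
  next
    show "?Y \<subseteq> convex hull ?X"
    proof clarify
      fix y t
      assume y: "y \<in> C" "p y \<le> t"
      obtain a where a: "0 \<le> a" "y + a *\<^sub>R d \<in> C" "q (y + a *\<^sub>R d) = p (y + a *\<^sub>R d)"
        using forward[OF y(1)] by blast
      obtain c where c: "0 \<le> c" "y + (- c) *\<^sub>R d \<in> C" "q (y + (- c) *\<^sub>R d) = p (y + (- c) *\<^sub>R d)"
        using backward[OF y(1)] by blast
      \<comment> \<open>The height follows the slope of \<open>p\<close> along the line, so the
        slack \<open>t - p y\<close> is preserved and the heights average back to \<open>t\<close>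
        with the same weights as the points.\<close>
      have in_X: "stack (y + s *\<^sub>R d) 1 (t + s * (2 * (g \<bullet> d))) \<in> convex hull ?X"
        if "y + s *\<^sub>R d \<in> C" "q (y + s *\<^sub>R d) = p (y + s *\<^sub>R d)" for s
      proof (rule hull_inc)
        have "q (y + s *\<^sub>R d) \<le> t + s * (2 * (g \<bullet> d))"
          using that y p_line[of y s] by simp
        then show "stack (y + s *\<^sub>R d) 1 (t + s * (2 * (g \<bullet> d))) \<in> ?X"
          using that by blast
      qed
      show "stack y 1 t \<in> convex hull ?X"
      \<comment> \<open>The weights below divide by \<open>a + c\<close>. If it is zero, then so is
        \<open>a\<close>, and \<open>y\<close> itself already satisfies
        \<open>q y = p y\<close>.\<close>
      proof (cases "a + c = 0")
        case True
        then have "a = 0"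
          using a c by linarith
        then show ?thesis
          using in_X[of a] a by simp
      next
        case False
        \<comment> \<open>The weights are chosen so that the displacements \<open>a\<close> and
          \<open>- c\<close> cancel.\<close>
        define u where "u = c / (a + c)"
        define v where "v = a / (a + c)"
        have uv: "0 \<le> u" "0 \<le> v" "u + v = 1" "u * a + v * (- c) = 0"
          using a c False by (auto simp: u_def v_def simp flip: add_divide_distrib)
        have comb_y: "u *\<^sub>R (y + a *\<^sub>R d) + v *\<^sub>R (y + (- c) *\<^sub>R d) = y"
        proof -
          have "u *\<^sub>R (y + a *\<^sub>R d) + v *\<^sub>R (y + (- c) *\<^sub>R d) =
              (u + v) *\<^sub>R y + (u * a + v * (- c)) *\<^sub>R d"
            by (simp add: algebra_simps)
          then show ?thesis
            using uv by simp
        qed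
        have comb_t: "u * (t + a * (2 * (g \<bullet> d))) + v * (t + (- c) * (2 * (g \<bullet> d))) = t"
        proof -
          have "u * (t + a * (2 * (g \<bullet> d))) + v * (t + (- c) * (2 * (g \<bullet> d))) =
              (u + v) * t + (u * a + v * (- c)) * (2 * (g \<bullet> d))"
            by (simp add: algebra_simps)
          then show ?thesis
            using uv by simp
        qed
        have "u *\<^sub>R stack (y + a *\<^sub>R d) 1 (t + a * (2 * (g \<bullet> d))) +
            v *\<^sub>R stack (y + (- c) *\<^sub>R d) 1 (t + (- c) * (2 * (g \<bullet> d))) \<in> convex hull ?X"
          using in_X a c uv by (intro convexD[OF convex_convex_hull])
        then show ?thesis
          unfolding stack_convex_comb comb_y comb_t using uv by simp
      qed
    qed
  qed
  moreover have "\<exists>y z. is_arg_min q (\<lambda>y. y \<in> C) y \<and> is_arg_min p (\<lambda>y. y \<in> C) z \<and> q y = p z"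
  proof -
    have ne: "C \<noteq> {}"
      using assms(6) by (simp add: C_def)
    have "continuous_on C q" "continuous_on C p"
      unfolding q_def p_def
      by (intro continuous_intros continuous_on_form)+
    then obtain y z where y: "y \<in> C" "\<And>x. x \<in> C \<Longrightarrow> q y \<le> q x"
      and z: "z \<in> C" "\<And>x. x \<in> C \<Longrightarrow> p z \<le> p x"
      using continuous_attains_inf[OF compC ne] by metis
    \<comment> \<open>By \<open>p_line\<close>, moving by \<open>s\<close> changes \<open>p\<close>
      by twice \<open>s * (g \<bullet> d)\<close>, so the sign of \<open>g \<bullet> d\<close>
      decides which way to leave the minimizer \<open>z\<close> without increasing \<open>p\<close>.
      The value of \<open>q\<close> at the point reached bounds \<open>q y\<close> from above by
      \<open>p z\<close>.\<close>
    have "\<exists>s. s * (g \<bullet> d) \<le> 0 \<and> z + s *\<^sub>R d \<in> C \<and> q (z + s *\<^sub>R d) = p (z + s *\<^sub>R d)"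
    proof (cases "g \<bullet> d \<le> 0")
      case True
      then show ?thesis
        using forward[OF z(1)] mult_nonneg_nonpos by blast
    next
      case False
      then show ?thesis
        using backward[OF z(1)] by (metis linear minus_mult_left mult_nonneg_nonneg neg_le_0_iff_le)
    qed
    then have "q y \<le> p z"
      using y(2) p_line by force
    moreover have "p z \<le> q y"
      using z(2)[OF y(1)] p_le_q[OF y(1)] by linarith
    ultimately show ?thesis
      using y z by (intro exI[of _ y] exI[of _ z]) (auto simp: is_arg_min_linorder)
  qed
  ultimately show ?thesis
    \<comment> \<open>The two sets in the statement list their constraints in different orders, so
      the conjuncts are rearranged after unfolding.\<close>
    unfolding C_def mem_Collect_eq q_def p_def l_def
    by (simp only: conj_assoc conj_commute conj_left_commute)
qed

end
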